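(* Let $(\Omega,\mathcal F,\mathsf P)$ be a probability space and let $(X_n)_{n\in\mathbb N}$ be a sequence of i.i.d. integrable random variables on it with $\mathsf E_{\mathsf P}[X_1]=0$. Let $S_n:=\sum_{i=1}^n X_i$ and define $$\mathsf U_{\mathsf P}(x):=\mathsf E_{\mathsf P}\big[|X_1|\mathbf 1\{|X_1|\ge x\}\big],\qquad x\ge 0.$$ Then for any $\lambda\in(0,1/2)$, $\varepsilon>0$, and $m\in\mathbb N$, $$\mathsf P\left[\sup_{k\ge m}\frac{|S_k|}{k}\ge\varepsilon\right]\le\frac{262}{\varepsilon^2\wedge 1}\left(m^{2\lambda-1}+\mathsf U_{\mathsf P}(m^\lambda)\right).$$
   Context: $\mathbb N=\{1,2,\dots\}$; $a\wedge b=\min(a,b)$; random variables are real-valued; $\mathsf E_{\mathsf P}$ denotes expectation under $\mathsf P$. *)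

theory Defs
  imports "HOL-Probability.Probability"
begin

text \<open>Sequences are indexed by the positive integers, so \<open>X 0\<close> is unconstrained.\<close>

definition iid_seq :: "'a measure \<Rightarrow> (nat \<Rightarrow> 'a \<Rightarrow> real) \<Rightarrow> bool" where
  "iid_seq P X \<longleftrightarrow>
     prob_space.indep_vars P (\<lambda>_. borel) X {1..} \<and>
     (\<forall>n\<ge>1. distr P borel (X n) = distr P borel (X 1))"

definition partial_sum :: "(nat \<Rightarrow> 'a \<Rightarrow> real) \<Rightarrow> nat \<Rightarrow> 'a \<Rightarrow> real" where
  "partial_sum X n \<omega> = (\<Sum>i=1..n. X i \<omega>)"

definition truncated_abs_moment :: "'a measure \<Rightarrow> ('a \<Rightarrow> real) \<Rightarrow> real \<Rightarrow> real" where
  "truncated_abs_moment P Y x =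
     (\<integral>\<omega>. \<bar>Y \<omega>\<bar> * indicator {\<omega>. \<bar>Y \<omega>\<bar> \<ge> x} \<omega> \<partial>P)"

end

theory Submission
  imports Defs
begin

text \<open>
  The averages \<open>S k / k\<close> of an i.i.d. integrable sequence form a martingale when \<open>k\<close> runs backwards:
  given \<open>S k\<close> and all later terms, the first \<open>k\<close> terms are exchangeable, so the conditional
  expectation of each of them, and hence of \<open>S j / j\<close> for every \<open>j \<le> k\<close>, is \<open>S k / k\<close>.  Doob's maximal
  inequality for this reversed martingale (\<open>average_maximal_inequality\<close>) bounds the probability
  that a convex nonnegative function \<open>\<phi>\<close> of some average \<open>S k / k\<close> with \<open>k \<ge> m\<close> reaches a level
  \<open>a > 0\<close> by the expectation of \<open>\<phi> (S m / m)\<close>, divided by \<open>a\<close>: the whole infinite horizon costs no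
  more than the single index \<open>m\<close>.

  To apply it, each term is cut at the height \<open>c = m powr l\<close> and written as \<open>X i = Y i + Z i\<close>, where
  \<open>Y i\<close> is the centred part of \<open>X i\<close> below \<open>c\<close> and \<open>Z i\<close> is the rest.

  For \<open>Y\<close>, which is bounded and centred, take \<open>\<phi>\<close> to be the square: the second moment of the average
  at \<open>m\<close> is the variance of one term divided by \<open>m\<close>, thus at most \<open>c\<^sup>2 / m = m powr (2 * l - 1)\<close>
  (\<open>average_maximal_inequality_square\<close>).

  For \<open>Z\<close>, take \<open>\<phi>\<close> to be the absolute value: the mean absolute value of the average at \<open>m\<close> is at
  most that of one term (\<open>average_maximal_inequality_abs\<close>).  As \<open>X 1\<close> has mean zero, the centring
  constant is up to sign the mean of \<open>X 1\<close> above \<open>c\<close>, so that one term contributes at most twice the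
  truncated moment.

  Both estimates are used at the level \<open>\<epsilon> / 4\<close>, which gives the claim with constant \<open>16\<close>, well
  below \<open>262\<close>.
\<close>

section \<open>Sequences of independent identically distributed variables\<close>

lemma (in prob_space) iid_seq_indep_vars:
  "iid_seq M Y \<Longrightarrow> J \<subseteq> {1..} \<Longrightarrow> indep_vars (\<lambda>_. borel) Y J"
  unfolding iid_seq_def by (blast intro: indep_vars_subset)

lemma (in prob_space) iid_seq_random_variable:
  assumes "iid_seq M Y" "1 \<le> i"
  shows "Y i \<in> borel_measurable M"
  using iid_seq_indep_vars[OF assms(1), of "{1..}"] assms(2) by (auto simp: indep_vars_def)

lemma iid_seq_distr_eq:
  assumes "iid_seq M Y" "1 \<le> i"
  shows "distr M borel (Y i) = distr M borel (Y 1)"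
  by (rule assms(1)[unfolded iid_seq_def, THEN conjunct2, rule_format, OF assms(2)])

lemma (in prob_space) iid_seq_same_expectation:
  fixes g :: "real \<Rightarrow> real"
  assumes iid: "iid_seq M Y" and i: "1 \<le> i" and g [measurable]: "g \<in> borel_measurable borel"
  shows "integrable M (\<lambda>\<omega>. g (Y i \<omega>)) \<longleftrightarrow> integrable M (\<lambda>\<omega>. g (Y 1 \<omega>))" (is ?I)
    and "expectation (\<lambda>\<omega>. g (Y i \<omega>)) = expectation (\<lambda>\<omega>. g (Y 1 \<omega>))" (is ?E)
proof -
  have D: "distr M borel (Y i) = distr M borel (Y 1)"
    by (rule iid_seq_distr_eq[OF iid i])
  have [measurable]: "Y i \<in> borel_measurable M" "Y 1 \<in> borel_measurable M"
    using iid_seq_random_variable[OF iid] i by auto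
  show ?I
    using integrable_distr_eq[of "Y i" M borel g] integrable_distr_eq[of "Y 1" M borel g] D by (simp del: One_nat_def)
  show ?E
    using integral_distr[of "Y i" M borel g] integral_distr[of "Y 1" M borel g] D by (simp del: One_nat_def)
qed

lemma (in prob_space) iid_seq_compose:
  assumes iid: "iid_seq M X" and f [measurable]: "f \<in> borel_measurable borel"
  shows "iid_seq M (\<lambda>n \<omega>. f (X n \<omega>))"
  unfolding iid_seq_def
proof (intro conjI allI impI)
  show "indep_vars (\<lambda>_. borel) (\<lambda>n \<omega>. f (X n \<omega>)) {1..}"
    by (rule indep_vars_compose2[OF iid_seq_indep_vars[OF iid order_refl] f])
  fix n :: nat assume n: "1 \<le> n"
  have X [measurable]: "X n \<in> borel_measurable M" "X 1 \<in> borel_measurable M"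
    using iid_seq_random_variable[OF iid] n by auto
  have "distr M borel (\<lambda>\<omega>. f (X n \<omega>)) = distr (distr M borel (X n)) borel f"
    by (simp add: distr_distr o_def)
  also have "distr M borel (X n) = distr M borel (X 1)"
    by (rule iid_seq_distr_eq[OF iid n])
  also have "distr (distr M borel (X 1)) borel f = distr M borel (\<lambda>\<omega>. f (X 1 \<omega>))"
    by (simp add: distr_distr o_def del: One_nat_def)
  finally show "distr M borel (\<lambda>\<omega>. f (X n \<omega>)) = distr M borel (\<lambda>\<omega>. f (X 1 \<omega>))" .
qed

section \<open>Exchangeability\<close>

text \<open>
  The joint law of \<open>Y 1, \<dots>, Y N\<close> is the \<open>N\<close>-fold power of a single measure, and such a power
  does not change when its coordinates are permuted.
\<close>

lemma (in prob_space) iid_seq_permute_expectation: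
  fixes Y :: "nat \<Rightarrow> 'a \<Rightarrow> real" and f :: "(nat \<Rightarrow> real) \<Rightarrow> real"
  assumes iid: "iid_seq M Y"
    and \<sigma>: "\<sigma> permutes {1..N}"
    and f: "f \<in> borel_measurable (\<Pi>\<^sub>M n\<in>{1..N}. borel)"
  shows "expectation (\<lambda>\<omega>. f (\<lambda>n\<in>{1..N}. Y (\<sigma> n) \<omega>))
       = expectation (\<lambda>\<omega>. f (\<lambda>n\<in>{1..N}. Y n \<omega>))"
proof (cases "N = 0")
  case True
  then show ?thesis by (simp add: restrict_def)
next
  case False
  define I where "I = {1..N}"
  let ?B = "\<Pi>\<^sub>M n\<in>I. (borel :: real measure)"
  define \<mu> where "\<mu> = distr M borel (Y 1)"
  define V where "V = (\<lambda>\<omega>. \<lambda>n\<in>I. Y n \<omega>)"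
  define \<pi> where "\<pi> = (\<lambda>x :: nat \<Rightarrow> real. \<lambda>n\<in>I. x (\<sigma> n))"
  have rv [measurable]: "random_variable borel (Y i)" if "i \<in> I" for i
    using iid_seq_random_variable[OF iid] that by (auto simp: I_def)
  have V [measurable]: "V \<in> measurable M ?B"
    unfolding V_def by measurable
  have I: "\<sigma> ` I = I" "\<And>n. n \<in> I \<Longrightarrow> \<sigma> n \<in> I"
    using permutes_image[OF \<sigma>] permutes_in_image[OF \<sigma>] by (auto simp: I_def)
  have \<pi> [measurable]: "\<pi> \<in> measurable ?B ?B"
    unfolding \<pi>_def using I(2) by measurable
  have f' [measurable]: "f \<in> borel_measurable ?B" using f by (simp add: I_def)
  have "prob_space \<mu>"
    unfolding \<mu>_def using rv[of 1] False by (intro prob_space_distr) (auto simp: I_def)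
  have indep: "indep_vars (\<lambda>_. borel) Y I"
    using iid by (rule iid_seq_indep_vars) (auto simp: I_def)
  have "I \<noteq> {}" using False by (simp add: I_def)
  then have "distr M ?B V = (\<Pi>\<^sub>M i\<in>I. distr M borel (Y i))"
    unfolding V_def by (intro iffD1[OF indep_vars_iff_distr_eq_PiM' indep] rv)
  also have "\<dots> = (\<Pi>\<^sub>M i\<in>I. \<mu>)"
  proof (intro PiM_cong refl)
    show "distr M borel (Y i) = \<mu>" if "i \<in> I" for i
      unfolding \<mu>_def using that by (intro iid_seq_distr_eq[OF iid]) (simp add: I_def)
  qed
  finally have D: "distr M ?B V = (\<Pi>\<^sub>M i\<in>I. \<mu>)" .
  have sets_eq: "sets (\<Pi>\<^sub>M i\<in>I. \<mu>) = sets ?B"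
    by (intro sets_PiM_cong) (auto simp: \<mu>_def)
  have "distr (\<Pi>\<^sub>M i\<in>I. \<mu>) ?B \<pi> = distr (\<Pi>\<^sub>M i\<in>I. \<mu>) (\<Pi>\<^sub>M i\<in>I. \<mu>) \<pi>"
    by (rule distr_cong) (auto simp: sets_eq)
  also have "\<dots> = (\<Pi>\<^sub>M i\<in>I. \<mu>)"
    unfolding \<pi>_def using \<open>prob_space \<mu>\<close> I(2) permutes_inj_on[OF \<sigma>]
    by (intro distr_PiM_reindex) auto
  finally have inv: "distr (distr M ?B V) ?B \<pi> = distr M ?B V"
    by (simp add: D)
  have "expectation (\<lambda>\<omega>. f (V \<omega>)) = (\<integral>x. f x \<partial>distr (distr M ?B V) ?B \<pi>)"
    unfolding inv by (simp add: integral_distr)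
  also have "\<dots> = expectation (\<lambda>\<omega>. f (\<pi> (V \<omega>)))"
    by (simp add: integral_distr)
  also have "(\<lambda>\<omega>. \<pi> (V \<omega>)) = (\<lambda>\<omega>. \<lambda>n\<in>I. Y (\<sigma> n) \<omega>)"
    using I(2) by (auto simp: \<pi>_def V_def fun_eq_iff)
  finally show ?thesis unfolding V_def I_def by (rule sym)
qed

lemma (in prob_space) iid_seq_exchange_weighted:
  fixes Y :: "nat \<Rightarrow> 'a \<Rightarrow> real" and H :: "(nat \<Rightarrow> real) \<Rightarrow> real"
  assumes iid: "iid_seq M Y"
    and i: "1 \<le> i" "i \<le> N"
    and H [measurable]: "H \<in> borel_measurable (\<Pi>\<^sub>M n\<in>{1..N}. borel)"
    and sym: "\<And>x. H (\<lambda>n\<in>{1..N}. x (Transposition.transpose 1 i n)) = H (\<lambda>n\<in>{1..N}. x n)"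
  shows "expectation (\<lambda>\<omega>. Y i \<omega> * H (\<lambda>n\<in>{1..N}. Y n \<omega>))
       = expectation (\<lambda>\<omega>. Y 1 \<omega> * H (\<lambda>n\<in>{1..N}. Y n \<omega>))"
proof -
  have perm: "Transposition.transpose 1 i permutes {1..N}"
    using i by (intro permutes_swap_id) auto
  have "(1::nat) \<in> {1..N}" using i by auto
  then have "(\<lambda>x. x 1 * H x) \<in> borel_measurable (\<Pi>\<^sub>M n\<in>{1..N}. borel)"
    by measurable
  from iid_seq_permute_expectation[OF iid perm this] show ?thesis
    using i sym[of "\<lambda>n. Y n _"] by simp
qed

text \<open>
  The reversed martingale property in weak form.  A weight \<open>H\<close> that is symmetric in the first
  \<open>k\<close> coordinates is what a function of \<open>S k\<close> and the later terms looks like; tested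
  against it, all terms up to \<open>k\<close> have the same expectation.  Since the right-hand side of the
  conclusion does not involve \<open>j\<close>, the averages at \<open>j\<close> and at \<open>k\<close> agree when tested against
  \<open>H\<close>.
\<close>

lemma (in prob_space) average_weighted_expectation:
  fixes Y :: "nat \<Rightarrow> 'a \<Rightarrow> real" and H :: "(nat \<Rightarrow> real) \<Rightarrow> real"
  assumes iid: "iid_seq M Y"
    and j: "1 \<le> j" "j \<le> k" "k \<le> N"
    and H: "H \<in> borel_measurable (\<Pi>\<^sub>M n\<in>{1..N}. borel)"
    and sym: "\<And>x i. 1 \<le> i \<Longrightarrow> i \<le> k \<Longrightarrow>
      H (\<lambda>n\<in>{1..N}. x (Transposition.transpose 1 i n)) = H (\<lambda>n\<in>{1..N}. x n)"
    and int: "\<And>i. 1 \<le> i \<Longrightarrow> i \<le> k \<Longrightarrow>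
      integrable M (\<lambda>\<omega>. Y i \<omega> * H (\<lambda>n\<in>{1..N}. Y n \<omega>))"
  shows "integrable M (\<lambda>\<omega>. partial_sum Y j \<omega> / real j * H (\<lambda>n\<in>{1..N}. Y n \<omega>))" (is ?I)
    and "expectation (\<lambda>\<omega>. partial_sum Y j \<omega> / real j * H (\<lambda>n\<in>{1..N}. Y n \<omega>))
       = expectation (\<lambda>\<omega>. Y 1 \<omega> * H (\<lambda>n\<in>{1..N}. Y n \<omega>))" (is ?E)
proof -
  have eq: "partial_sum Y j \<omega> / real j * H (\<lambda>n\<in>{1..N}. Y n \<omega>)
      = (\<Sum>i=1..j. Y i \<omega> * H (\<lambda>n\<in>{1..N}. Y n \<omega>)) / real j" for \<omega>
    by (simp add: partial_sum_def sum_distrib_right)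
  have int': "integrable M (\<lambda>\<omega>. Y i \<omega> * H (\<lambda>n\<in>{1..N}. Y n \<omega>))" if "i \<in> {1..j}" for i
    using that j by (intro int) auto
  show ?I
    unfolding eq by (intro integrable_divide Bochner_Integration.integrable_sum int')
  have "expectation (\<lambda>\<omega>. Y i \<omega> * H (\<lambda>n\<in>{1..N}. Y n \<omega>))
      = expectation (\<lambda>\<omega>. Y 1 \<omega> * H (\<lambda>n\<in>{1..N}. Y n \<omega>))" if "i \<in> {1..j}" for i
    using that j sym by (intro iid_seq_exchange_weighted[OF iid _ _ H]) auto
  then have "(\<Sum>i=1..j. expectation (\<lambda>\<omega>. Y i \<omega> * H (\<lambda>n\<in>{1..N}. Y n \<omega>)))
      = (\<Sum>i=1..j. expectation (\<lambda>\<omega>. Y 1 \<omega> * H (\<lambda>n\<in>{1..N}. Y n \<omega>)))"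
    by (rule sum.cong[OF refl])
  moreover have "expectation (\<lambda>\<omega>. \<Sum>i=1..j. Y i \<omega> * H (\<lambda>n\<in>{1..N}. Y n \<omega>))
      = (\<Sum>i=1..j. expectation (\<lambda>\<omega>. Y i \<omega> * H (\<lambda>n\<in>{1..N}. Y n \<omega>)))"
    by (intro Bochner_Integration.integral_sum int')
  ultimately show ?E
    unfolding eq using j by simp
qed

section \<open>The maximal inequality for averages\<close>

text \<open>
  Doob's argument with time reversed: the event is split according to the \<^emph>\<open>last\<close> index
  \<open>k \<le> N\<close> at which the level \<open>a\<close> is reached.  Whether \<open>k\<close> is this index depends only on the sums from
  \<open>k\<close> on, so it is a symmetric condition on the first \<open>k\<close> terms.  On this piece
  \<open>a \<le> \<phi> (S k / k)\<close>, and replacing \<open>S k / k\<close> by \<open>S m / m\<close> in the integral of \<open>\<phi>\<close> can only increase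
  it: the first-order error term, with the subgradient \<open>\<psi>\<close> of \<open>\<phi>\<close> as weight, integrates to zero by
  \<open>average_weighted_expectation\<close>.
\<close>

lemma (in prob_space) average_maximal_inequality_finite:
  fixes Y :: "nat \<Rightarrow> 'a \<Rightarrow> real" and \<phi> \<psi> :: "real \<Rightarrow> real"
  assumes iid: "iid_seq M Y"
    and meas [measurable]: "\<phi> \<in> borel_measurable borel" "\<psi> \<in> borel_measurable borel"
    and subgradient: "\<And>x y. \<phi> x + \<psi> x * (y - x) \<le> \<phi> y"
    and nonneg: "\<And>x. 0 \<le> \<phi> x"
    and m: "1 \<le> m" "m \<le> N"
    and int_\<phi>: "integrable M (\<lambda>\<omega>. \<phi> (partial_sum Y m \<omega> / real m))"
    and int_\<psi>: "\<And>i k. 1 \<le> i \<Longrightarrow> i \<le> k \<Longrightarrow>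
      integrable M (\<lambda>\<omega>. Y i \<omega> * \<psi> (partial_sum Y k \<omega> / real k))"
  shows "a * prob {\<omega>\<in>space M. \<exists>k\<in>{m..N}. a \<le> \<phi> (partial_sum Y k \<omega> / real k)}
       \<le> expectation (\<lambda>\<omega>. \<phi> (partial_sum Y m \<omega> / real m))"
proof -
  define R where "R = (\<lambda>k \<omega>. partial_sum Y k \<omega> / real k)"
  define last where "last = (\<lambda>k (r :: nat \<Rightarrow> real). a \<le> \<phi> (r k) \<and> (\<forall>j\<in>{k<..N}. \<phi> (r j) < a))"
  define K where "K = (\<lambda>k. {\<omega>\<in>space M. last k (\<lambda>j. R j \<omega>)})"
  have rv [measurable]: "Y i \<in> borel_measurable M" if "i \<in> {1..}" for i
    using iid_seq_random_variable[OF iid] that by auto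
  have R [measurable]: "R k \<in> borel_measurable M" for k
    unfolding R_def partial_sum_def by measurable
  have K [measurable]: "K k \<in> sets M" for k
    unfolding K_def last_def by measurable
  have step: "a * prob (K k) \<le> expectation (\<lambda>\<omega>. \<phi> (R m \<omega>) * indicator (K k) \<omega>)"
    and int_K: "integrable M (\<lambda>\<omega>. \<phi> (R m \<omega>) * indicator (K k) \<omega>)"
    if k: "k \<in> {m..N}" for k
  proof -
    define avg where "avg = (\<lambda>(x :: nat \<Rightarrow> real) j. (\<Sum>i=1..j. x i) / real j)"
    \<comment> \<open>The weight as a function of the first \<open>N\<close> values, so that its symmetry can be stated.\<close>
    define H where "H = (\<lambda>x. if last k (avg x) then \<psi> (avg x k) else 0)"
    have avg_meas [measurable]: "(\<lambda>x. avg x j) \<in> borel_measurable (\<Pi>\<^sub>M n\<in>{1..N}. borel)"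
      if "j \<le> N" for j
      unfolding avg_def using that by (intro borel_measurable_divide borel_measurable_sum measurable_component_singleton) auto
    have H_meas: "H \<in> borel_measurable (\<Pi>\<^sub>M n\<in>{1..N}. borel)"
    proof -
      have [measurable]: "Measurable.pred (\<Pi>\<^sub>M n\<in>{1..N}. borel) (\<lambda>x. last k (avg x))"
        unfolding last_def using k
        by (intro pred_intros_logic pred_intros_countable_bounded measurable_compose[OF avg_meas])
           (auto intro!: measurable_compose[OF avg_meas])
      have [measurable]: "(\<lambda>x. avg x k) \<in> borel_measurable (\<Pi>\<^sub>M n\<in>{1..N}. borel)"
        using k by (intro avg_meas) auto
      show ?thesis unfolding H_def by measurable
    qed
    have H_cong: "H x = H y" if "\<And>j. j \<in> {k..N} \<Longrightarrow> avg x j = avg y j" for x y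
      using that k by (auto simp: H_def last_def)
    have H_sym: "H (\<lambda>n\<in>{1..N}. x (Transposition.transpose 1 i n)) = H (\<lambda>n\<in>{1..N}. x n)"
      if i: "1 \<le> i" "i \<le> k" for x i
    proof (rule H_cong)
      fix j assume j: "j \<in> {k..N}"
      have "(\<Sum>n=1..j. x (Transposition.transpose 1 i n)) = (\<Sum>n=1..j. x n)"
        using i j sum.permute[OF permutes_swap_id, of 1 "{1..j}" i x] by (simp add: o_def)
      with j show "avg (\<lambda>n\<in>{1..N}. x (Transposition.transpose 1 i n)) j = avg (\<lambda>n\<in>{1..N}. x n) j"
        by (simp add: avg_def)
    qed
    have avg_Y: "avg (\<lambda>n\<in>{1..N}. Y n \<omega>) j = R j \<omega>" if "j \<le> N" for j \<omega>
      using that by (simp add: avg_def R_def partial_sum_def)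
    have H_Y: "H (\<lambda>n\<in>{1..N}. Y n \<omega>) = \<psi> (R k \<omega>) * indicator (K k) \<omega>" if "\<omega> \<in> space M" for \<omega>
    proof -
      let ?v = "\<lambda>n\<in>{1..N}. Y n \<omega>"
      have "last k (avg ?v) \<longleftrightarrow> last k (\<lambda>j. R j \<omega>)"
        unfolding last_def using k by (intro conj_cong ball_cong) (simp_all only: avg_Y greaterThanAtMost_iff atLeastAtMost_iff)
      moreover have "avg ?v k = R k \<omega>"
        using k by (intro avg_Y) simp
      ultimately show ?thesis
        using that by (simp add: H_def K_def)
    qed
    have int_H: "integrable M (\<lambda>\<omega>. Y i \<omega> * H (\<lambda>n\<in>{1..N}. Y n \<omega>))" if "1 \<le> i" "i \<le> k" for i
    proof -
      have "integrable M (\<lambda>\<omega>. (Y i \<omega> * \<psi> (R k \<omega>)) * indicator (K k) \<omega>)"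
        unfolding R_def by (intro integrable_real_mult_indicator K int_\<psi> that)
      also have "?this \<longleftrightarrow> ?thesis"
        by (intro Bochner_Integration.integrable_cong refl) (simp only: H_Y mult.assoc)
      finally show ?thesis .
    qed
    have int_R: "integrable M (\<lambda>\<omega>. R j \<omega> * (\<psi> (R k \<omega>) * indicator (K k) \<omega>))"
      and E_R: "expectation (\<lambda>\<omega>. R j \<omega> * (\<psi> (R k \<omega>) * indicator (K k) \<omega>))
        = expectation (\<lambda>\<omega>. Y 1 \<omega> * (\<psi> (R k \<omega>) * indicator (K k) \<omega>))" if "j \<in> {m..k}" for j
    proof -
      have j: "1 \<le> j" "j \<le> k" "k \<le> N" using that k m by auto
      have cong: "partial_sum Y j \<omega> / real j * H (\<lambda>n\<in>{1..N}. Y n \<omega>)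
          = R j \<omega> * (\<psi> (R k \<omega>) * indicator (K k) \<omega>)"
        "Y 1 \<omega> * H (\<lambda>n\<in>{1..N}. Y n \<omega>) = Y 1 \<omega> * (\<psi> (R k \<omega>) * indicator (K k) \<omega>)"
        if "\<omega> \<in> space M" for \<omega>
        by (simp_all only: H_Y[OF that]) (simp only: R_def)
      show "integrable M (\<lambda>\<omega>. R j \<omega> * (\<psi> (R k \<omega>) * indicator (K k) \<omega>))"
        using average_weighted_expectation(1)[OF iid j H_meas H_sym int_H]
        by (simp only: cong cong: Bochner_Integration.integrable_cong)
      show "expectation (\<lambda>\<omega>. R j \<omega> * (\<psi> (R k \<omega>) * indicator (K k) \<omega>))
          = expectation (\<lambda>\<omega>. Y 1 \<omega> * (\<psi> (R k \<omega>) * indicator (K k) \<omega>))"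
        using average_weighted_expectation(2)[OF iid j H_meas H_sym int_H]
        by (simp only: cong cong: Bochner_Integration.integral_cong)
    qed
    show int_K: "integrable M (\<lambda>\<omega>. \<phi> (R m \<omega>) * indicator (K k) \<omega>)"
      unfolding R_def by (intro integrable_real_mult_indicator K int_\<phi>)
    have int_a: "integrable M (\<lambda>\<omega>. a * indicator (K k) \<omega>)"
      by (simp add: less_top[symmetric])
    \<comment> \<open>The first-order error when the average at \<open>k\<close> is replaced by the average at \<open>m\<close>.\<close>
    let ?D = "\<lambda>\<omega>. R m \<omega> * (\<psi> (R k \<omega>) * indicator (K k) \<omega>) - R k \<omega> * (\<psi> (R k \<omega>) * indicator (K k) \<omega>)"
    have int_D: "integrable M ?D"
      using k by (intro Bochner_Integration.integrable_diff int_R) auto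
    have "expectation ?D = 0"
      using k by (simp add: int_R E_R)
    then have "a * prob (K k) = expectation (\<lambda>\<omega>. a * indicator (K k) \<omega> + ?D \<omega>)"
      using int_a int_D by (simp add: less_top[symmetric])
    also have "\<dots> \<le> expectation (\<lambda>\<omega>. \<phi> (R m \<omega>) * indicator (K k) \<omega>)"
    proof (rule integral_mono)
      show "a * indicator (K k) \<omega> + ?D \<omega> \<le> \<phi> (R m \<omega>) * indicator (K k) \<omega>" for \<omega>
        using subgradient[of "R k \<omega>" "R m \<omega>"]
        by (auto simp: K_def last_def indicator_def algebra_simps)
    qed (use int_a int_D int_K in auto)
    finally show "a * prob (K k) \<le> expectation (\<lambda>\<omega>. \<phi> (R m \<omega>) * indicator (K k) \<omega>)" .
  qed
  have disj: "disjoint_family_on K {m..N}"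
  proof -
    have "K k \<inter> K l = {}" if "k < l" "l \<le> N" for k l
      using that by (force simp: K_def last_def)
    then show ?thesis
      unfolding disjoint_family_on_def
      by (metis Int_commute atLeastAtMost_iff linorder_neqE_nat)
  qed
  have union: "{\<omega>\<in>space M. \<exists>k\<in>{m..N}. a \<le> \<phi> (R k \<omega>)} = (\<Union>k\<in>{m..N}. K k)"
  proof safe
    fix \<omega> k assume \<omega>: "\<omega> \<in> space M" and k: "k \<in> {m..N}" "a \<le> \<phi> (R k \<omega>)"
    define T where "T = {k\<in>{m..N}. a \<le> \<phi> (R k \<omega>)}"
    have T: "finite T" "T \<noteq> {}" using k by (auto simp: T_def)
    have "Max T \<in> T" using Max_in[OF T] .
    moreover have "\<phi> (R j \<omega>) < a" if "j \<in> {Max T<..N}" for j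
    proof (rule ccontr)
      assume "\<not> \<phi> (R j \<omega>) < a"
      with that \<open>Max T \<in> T\<close> have "j \<in> T" by (auto simp: T_def)
      with that Max_ge[OF T(1)] show False by fastforce
    qed
    ultimately show "\<omega> \<in> (\<Union>k\<in>{m..N}. K k)"
      using \<omega> by (auto simp: K_def last_def T_def)
  qed (auto simp: K_def last_def)
  have "a * prob (\<Union>k\<in>{m..N}. K k) = (\<Sum>k\<in>{m..N}. a * prob (K k))"
    using disj by (subst finite_measure_finite_Union) (auto simp: sum_distrib_left)
  also have "\<dots> \<le> (\<Sum>k\<in>{m..N}. expectation (\<lambda>\<omega>. \<phi> (R m \<omega>) * indicator (K k) \<omega>))"
    by (intro sum_mono step)
  also have "\<dots> = expectation (\<lambda>\<omega>. \<Sum>k\<in>{m..N}. \<phi> (R m \<omega>) * indicator (K k) \<omega>)"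
    by (intro Bochner_Integration.integral_sum[symmetric] int_K)
  also have "\<dots> \<le> expectation (\<lambda>\<omega>. \<phi> (R m \<omega>))"
  proof (rule integral_mono)
    show "(\<Sum>k\<in>{m..N}. \<phi> (R m \<omega>) * indicator (K k) \<omega>) \<le> \<phi> (R m \<omega>)" for \<omega>
    proof -
      have "(\<Sum>k\<in>{m..N}. \<phi> (R m \<omega>) * indicator (K k) \<omega>)
          = \<phi> (R m \<omega>) * indicator (\<Union>k\<in>{m..N}. K k) \<omega>"
        by (simp only: sum_distrib_left[symmetric] indicator_UN_disjoint[OF finite_atLeastAtMost disj])
      also have "\<dots> \<le> \<phi> (R m \<omega>)"
        using nonneg[of "R m \<omega>"] by (simp add: indicator_def)
      finally show ?thesis .
    qed
    show "integrable M (\<lambda>\<omega>. \<phi> (R m \<omega>))"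
      unfolding R_def by (rule int_\<phi>)
    show "integrable M (\<lambda>\<omega>. \<Sum>k\<in>{m..N}. \<phi> (R m \<omega>) * indicator (K k) \<omega>)"
      by (intro Bochner_Integration.integrable_sum int_K)
  qed
  finally show ?thesis
    unfolding union[symmetric] R_def .
qed

text \<open>
  The bound for a finite horizon \<open>N\<close> does not depend on \<open>N\<close>, so it survives the limit.
\<close>

lemma (in prob_space) average_maximal_inequality:
  fixes Y :: "nat \<Rightarrow> 'a \<Rightarrow> real" and \<phi> \<psi> :: "real \<Rightarrow> real"
  assumes iid: "iid_seq M Y"
    and meas [measurable]: "\<phi> \<in> borel_measurable borel" "\<psi> \<in> borel_measurable borel"
    and subgradient: "\<And>x y. \<phi> x + \<psi> x * (y - x) \<le> \<phi> y"
    and nonneg: "\<And>x. 0 \<le> \<phi> x"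
    and m: "1 \<le> m"
    and int_\<phi>: "integrable M (\<lambda>\<omega>. \<phi> (partial_sum Y m \<omega> / real m))"
    and int_\<psi>: "\<And>i k. 1 \<le> i \<Longrightarrow> i \<le> k \<Longrightarrow>
      integrable M (\<lambda>\<omega>. Y i \<omega> * \<psi> (partial_sum Y k \<omega> / real k))"
  shows "a * prob {\<omega>\<in>space M. \<exists>k\<ge>m. a \<le> \<phi> (partial_sum Y k \<omega> / real k)}
       \<le> expectation (\<lambda>\<omega>. \<phi> (partial_sum Y m \<omega> / real m))"
proof -
  define E where "E = (\<lambda>N. {\<omega>\<in>space M. \<exists>k\<in>{m..N}. a \<le> \<phi> (partial_sum Y k \<omega> / real k)})"
  have rv [measurable]: "Y i \<in> borel_measurable M" if "i \<in> {1..}" for i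
    using iid_seq_random_variable[OF iid] that by auto
  have [measurable]: "partial_sum Y k \<in> borel_measurable M" for k
    unfolding partial_sum_def by measurable
  have "E N \<in> sets M" for N
    unfolding E_def by measurable
  moreover have "incseq E"
    unfolding incseq_def E_def by fastforce
  ultimately have "(\<lambda>N. prob (E N)) \<longlonglongrightarrow> prob (\<Union>N. E N)"
    by (intro finite_Lim_measure_incseq) auto
  then have "(\<lambda>N. a * prob (E N)) \<longlonglongrightarrow> a * prob (\<Union>N. E N)"
    by (rule tendsto_mult_left)
  moreover have "a * prob (E N) \<le> expectation (\<lambda>\<omega>. \<phi> (partial_sum Y m \<omega> / real m))" if "m \<le> N" for N
    unfolding E_def using that
    by (intro average_maximal_inequality_finite[OF iid meas subgradient nonneg m _ int_\<phi> int_\<psi>])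
  ultimately have "a * prob (\<Union>N. E N) \<le> expectation (\<lambda>\<omega>. \<phi> (partial_sum Y m \<omega> / real m))"
    by (intro LIMSEQ_le_const2) auto
  also have "(\<Union>N. E N) = {\<omega>\<in>space M. \<exists>k\<ge>m. a \<le> \<phi> (partial_sum Y k \<omega> / real k)}"
    unfolding E_def atLeastAtMost_iff Bex_def by (blast intro: order_refl)
  finally show ?thesis .
qed

section \<open>Absolute values and squares\<close>

lemma (in prob_space) average_maximal_inequality_abs:
  assumes iid: "iid_seq M Y" and int: "integrable M (Y 1)" and m: "1 \<le> m"
  shows "a * prob {\<omega>\<in>space M. \<exists>k\<ge>m. a \<le> \<bar>partial_sum Y k \<omega> / real k\<bar>}
       \<le> expectation (\<lambda>\<omega>. \<bar>Y 1 \<omega>\<bar>)"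
proof -
  have rv [measurable]: "Y i \<in> borel_measurable M" if "i \<in> {1..}" for i
    using iid_seq_random_variable[OF iid] that by auto
  have [measurable]: "partial_sum Y k \<in> borel_measurable M" for k
    unfolding partial_sum_def by measurable
  have int_Y: "integrable M (Y i)" if "1 \<le> i" for i
    using iid_seq_same_expectation(1)[OF iid that, of "\<lambda>x. x"] int by simp
  have int_abs: "integrable M (\<lambda>\<omega>. \<bar>partial_sum Y m \<omega> / real m\<bar>)"
    unfolding partial_sum_def
    by (intro integrable_abs integrable_divide Bochner_Integration.integrable_sum int_Y) auto
  have int_sgn: "integrable M (\<lambda>\<omega>. Y i \<omega> * sgn (partial_sum Y k \<omega> / real k))" if "1 \<le> i" for i k
  proof (rule Bochner_Integration.integrable_bound[OF int_Y[OF that]])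
    show "(\<lambda>\<omega>. Y i \<omega> * sgn (partial_sum Y k \<omega> / real k)) \<in> borel_measurable M"
      using iid_seq_random_variable[OF iid that] unfolding sgn_if by measurable
    show "AE \<omega> in M. norm (Y i \<omega> * sgn (partial_sum Y k \<omega> / real k)) \<le> norm (Y i \<omega>)"
      by (intro AE_I2) (simp add: abs_mult abs_sgn_eq)
  qed
  have "a * prob {\<omega>\<in>space M. \<exists>k\<ge>m. a \<le> \<bar>partial_sum Y k \<omega> / real k\<bar>}
      \<le> expectation (\<lambda>\<omega>. \<bar>partial_sum Y m \<omega> / real m\<bar>)"
  proof (rule average_maximal_inequality[where \<phi> = abs and \<psi> = sgn, OF iid _ _ _ _ m int_abs int_sgn])
    have "(\<lambda>x :: real. if x = 0 then 0 else if 0 < x then 1 else - 1) \<in> borel_measurable borel"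
      by measurable
    then show "(sgn :: real \<Rightarrow> real) \<in> borel_measurable borel"
      by (subst sgn_if[abs_def])
    show "\<bar>x\<bar> + sgn x * (y - x) \<le> \<bar>y\<bar>" for x y :: real
      by (auto simp: sgn_if)
    show "(abs :: real \<Rightarrow> real) \<in> borel_measurable borel"
      by measurable
  qed (simp_all only: abs_ge_zero)
  also have "\<dots> \<le> expectation (\<lambda>\<omega>. (\<Sum>i=1..m. \<bar>Y i \<omega>\<bar>) / real m)"
  proof (rule integral_mono[OF int_abs])
    show "integrable M (\<lambda>\<omega>. (\<Sum>i=1..m. \<bar>Y i \<omega>\<bar>) / real m)"
      by (intro integrable_divide Bochner_Integration.integrable_sum integrable_abs int_Y) auto
    show "\<bar>partial_sum Y m \<omega> / real m\<bar> \<le> (\<Sum>i=1..m. \<bar>Y i \<omega>\<bar>) / real m" for \<omega>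
      unfolding partial_sum_def abs_divide abs_of_nat by (intro divide_right_mono sum_abs) simp
  qed
  also have "\<dots> = (\<Sum>i=1..m. expectation (\<lambda>\<omega>. \<bar>Y i \<omega>\<bar>)) / real m"
    using int_Y by (simp add: Bochner_Integration.integral_sum)
  also have "(\<Sum>i=1..m. expectation (\<lambda>\<omega>. \<bar>Y i \<omega>\<bar>)) = (\<Sum>i=1..m. expectation (\<lambda>\<omega>. \<bar>Y 1 \<omega>\<bar>))"
    by (intro sum.cong refl iid_seq_same_expectation(2)[OF iid, where g=abs]) auto
  finally show ?thesis using m by simp
qed

text \<open>
  Independence and the zero mean remove the mixed products, which leaves a sum of equal second
  moments; boundedness makes these finite.
\<close>

lemma (in prob_space) iid_seq_partial_sum_second_moment:
  assumes iid: "iid_seq M Y"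
    and bounded: "\<And>i \<omega>. 1 \<le> i \<Longrightarrow> \<omega> \<in> space M \<Longrightarrow> \<bar>Y i \<omega>\<bar> \<le> C"
    and mean: "expectation (Y 1) = 0"
  shows "integrable M (\<lambda>\<omega>. (partial_sum Y n \<omega>)\<^sup>2)"
    and "expectation (\<lambda>\<omega>. (partial_sum Y n \<omega>)\<^sup>2) = real n * expectation (\<lambda>\<omega>. (Y 1 \<omega>)\<^sup>2)"
proof -
  have rv [measurable]: "Y i \<in> borel_measurable M" if "i \<in> {1..}" for i
    using iid_seq_random_variable[OF iid] that by auto
  have [measurable]: "partial_sum Y k \<in> borel_measurable M" for k
    unfolding partial_sum_def by measurable
  have int_Y: "integrable M (Y i)" if "1 \<le> i" for i
    using that bounded[OF that] iid_seq_random_variable[OF iid that]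
    by (intro integrable_const_bound[where B=C] AE_I2) auto
  have int_S: "integrable M (partial_sum Y k)" for k
    unfolding partial_sum_def by (intro Bochner_Integration.integrable_sum int_Y) auto
  have int_Y2: "integrable M (\<lambda>\<omega>. (Y i \<omega>)\<^sup>2)" if "1 \<le> i" for i
  proof (rule integrable_const_bound[where B="C\<^sup>2"])
    show "AE \<omega> in M. norm ((Y i \<omega>)\<^sup>2) \<le> C\<^sup>2"
      using power_mono[OF bounded[OF that] abs_ge_zero, of _ 2] by (intro AE_I2) simp
    show "(\<lambda>\<omega>. (Y i \<omega>)\<^sup>2) \<in> borel_measurable M"
      using iid_seq_random_variable[OF iid that] by measurable
  qed
  have "integrable M (\<lambda>\<omega>. (partial_sum Y n \<omega>)\<^sup>2) \<and>
    expectation (\<lambda>\<omega>. (partial_sum Y n \<omega>)\<^sup>2) = real n * expectation (\<lambda>\<omega>. (Y 1 \<omega>)\<^sup>2)"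
  proof (induction n)
    case 0
    show ?case by (simp add: partial_sum_def)
  next
    case (Suc n)
    have "indep_vars (\<lambda>_. borel) Y (insert (Suc n) {1..n})"
      using iid by (rule iid_seq_indep_vars) auto
    then have ind: "indep_var borel (Y (Suc n)) borel (partial_sum Y n)"
      unfolding partial_sum_def by (intro indep_vars_sum) auto
    have int_prod: "integrable M (\<lambda>\<omega>. Y (Suc n) \<omega> * partial_sum Y n \<omega>)"
      by (rule indep_var_integrable[OF ind int_Y int_S]) simp
    have "expectation (Y (Suc n)) = 0"
      using iid_seq_same_expectation(2)[OF iid, of "Suc n" "\<lambda>x. x"] mean by simp
    then have E_prod: "expectation (\<lambda>\<omega>. Y (Suc n) \<omega> * partial_sum Y n \<omega>) = 0"
      using indep_var_lebesgue_integral[OF ind int_Y int_S] by simp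
    have E_Y2: "expectation (\<lambda>\<omega>. (Y (Suc n) \<omega>)\<^sup>2) = expectation (\<lambda>\<omega>. (Y 1 \<omega>)\<^sup>2)"
      by (rule iid_seq_same_expectation(2)[OF iid]) auto
    have "(partial_sum Y (Suc n) \<omega>)\<^sup>2
        = (partial_sum Y n \<omega>)\<^sup>2 + 2 * (Y (Suc n) \<omega> * partial_sum Y n \<omega>) + (Y (Suc n) \<omega>)\<^sup>2" for \<omega>
      by (simp add: partial_sum_def power2_eq_square algebra_simps)
    then show ?case
      using Suc.IH int_prod int_Y2[of "Suc n"] by (simp add: E_prod E_Y2 distrib_right)
  qed
  then show "integrable M (\<lambda>\<omega>. (partial_sum Y n \<omega>)\<^sup>2)"
    and "expectation (\<lambda>\<omega>. (partial_sum Y n \<omega>)\<^sup>2) = real n * expectation (\<lambda>\<omega>. (Y 1 \<omega>)\<^sup>2)"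
    by auto
qed

lemma (in prob_space) average_maximal_inequality_square:
  assumes iid: "iid_seq M Y"
    and bounded: "\<And>i \<omega>. 1 \<le> i \<Longrightarrow> \<omega> \<in> space M \<Longrightarrow> \<bar>Y i \<omega>\<bar> \<le> C"
    and mean: "expectation (Y 1) = 0"
    and m: "1 \<le> m" and a: "0 \<le> a"
  shows "a\<^sup>2 * prob {\<omega>\<in>space M. \<exists>k\<ge>m. a \<le> \<bar>partial_sum Y k \<omega> / real k\<bar>}
       \<le> expectation (\<lambda>\<omega>. (Y 1 \<omega>)\<^sup>2) / real m"
proof -
  have rv [measurable]: "Y i \<in> borel_measurable M" if "i \<in> {1..}" for i
    using iid_seq_random_variable[OF iid] that by auto
  have [measurable]: "partial_sum Y k \<in> borel_measurable M" for k
    unfolding partial_sum_def by measurable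
  note moment = iid_seq_partial_sum_second_moment[OF iid bounded mean]
  have int_sq: "integrable M (\<lambda>\<omega>. (partial_sum Y m \<omega> / real m)\<^sup>2)"
    using moment(1)[of m] by (simp add: power_divide)
  have int_prod: "integrable M (\<lambda>\<omega>. Y i \<omega> * (2 * (partial_sum Y k \<omega> / real k)))"
    if ik: "1 \<le> i" "i \<le> k" for i k
  proof (rule integrable_const_bound[where B="C * (2 * C)"])
    have "\<bar>Y i \<omega> * (2 * (partial_sum Y k \<omega> / real k))\<bar> \<le> C * (2 * C)" if \<omega>: "\<omega> \<in> space M" for \<omega>
    proof -
      have "\<bar>partial_sum Y k \<omega>\<bar> \<le> (\<Sum>i=1..k. \<bar>Y i \<omega>\<bar>)"
        unfolding partial_sum_def by (rule sum_abs)
      also have "\<dots> \<le> real (card {1..k}) * C"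
        using \<omega> bounded by (intro sum_bounded_above) auto
      finally have "\<bar>partial_sum Y k \<omega>\<bar> / real k \<le> C"
        using ik by (simp add: field_simps)
      moreover have "\<bar>Y i \<omega>\<bar> \<le> C" using bounded ik \<omega> by simp
      ultimately have "\<bar>Y i \<omega>\<bar> * (2 * (\<bar>partial_sum Y k \<omega>\<bar> / real k)) \<le> C * (2 * C)"
        by (intro mult_mono) auto
      then show ?thesis by (simp add: abs_mult)
    qed
    then show "AE \<omega> in M. norm (Y i \<omega> * (2 * (partial_sum Y k \<omega> / real k))) \<le> C * (2 * C)"
      by simp
    show "(\<lambda>\<omega>. Y i \<omega> * (2 * (partial_sum Y k \<omega> / real k))) \<in> borel_measurable M"
      using iid_seq_random_variable[OF iid ik(1)] by measurable
  qed
  have "a\<^sup>2 * prob {\<omega>\<in>space M. \<exists>k\<ge>m. a\<^sup>2 \<le> (partial_sum Y k \<omega> / real k)\<^sup>2}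
      \<le> expectation (\<lambda>\<omega>. (partial_sum Y m \<omega> / real m)\<^sup>2)"
  proof (rule average_maximal_inequality[where \<phi> = "\<lambda>x. x\<^sup>2" and \<psi> = "\<lambda>x. 2 * x",
        OF iid _ _ _ _ m int_sq int_prod])
    show "x\<^sup>2 + 2 * x * (y - x) \<le> y\<^sup>2" for x y :: real
      using zero_le_power2[of "y - x"] by (simp add: power2_eq_square algebra_simps)
  qed auto
  also have "\<dots> = expectation (\<lambda>\<omega>. (Y 1 \<omega>)\<^sup>2) / real m"
    using m by (simp add: power_divide moment(2)) (simp add: power2_eq_square)
  finally show ?thesis
    using a by (simp add: abs_le_square_iff[symmetric])
qed

section \<open>Truncation\<close>

theorem theorem2p1:
  fixes P :: "'a measure" and X :: "nat \<Rightarrow> 'a \<Rightarrow> real"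
    and l \<epsilon> :: real and m :: nat
  assumes "prob_space P"
    and "iid_seq P X"
    and "\<And>n. n \<ge> 1 \<Longrightarrow> integrable P (X n)"
    and "(\<integral>\<omega>. X 1 \<omega> \<partial>P) = 0"
    and "0 < l" and "l < 1/2"
    and "\<epsilon> > 0"
    and "m \<ge> 1"
  shows "measure P {\<omega> \<in> space P. (SUP k\<in>{m..}. ereal (\<bar>partial_sum X k \<omega>\<bar> / real k)) \<ge> ereal \<epsilon>}
    \<le> 262 / min (\<epsilon>\<^sup>2) 1 *
        (real m powr (2 * l - 1) + truncated_abs_moment P (X 1) (real m powr l))"
proof -
  interpret prob_space P by fact
  note iid = \<open>iid_seq P X\<close>
  define c where "c = real m powr l"
  define f where "f = (\<lambda>x :: real. if \<bar>x\<bar> < c then x else 0)"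
  define b where "b = expectation (\<lambda>\<omega>. f (X 1 \<omega>))"
  define Y where "Y = (\<lambda>i \<omega>. f (X i \<omega>) - b)"
  define Z where "Z = (\<lambda>i \<omega>. X i \<omega> - f (X i \<omega>) + b)"
  define U where "U = truncated_abs_moment P (X 1) c"
  define p where "p = real m powr (2 * l - 1)"
  define S where "S = (\<lambda>(V :: nat \<Rightarrow> 'a \<Rightarrow> real) k \<omega>. \<bar>partial_sum V k \<omega> / real k\<bar>)"
  have m: "0 < real m" using \<open>m \<ge> 1\<close> by simp
  have c: "0 < c" unfolding c_def using m by simp
  have f [measurable]: "f \<in> borel_measurable borel"
    unfolding f_def by measurable
  have X1 [measurable]: "X 1 \<in> borel_measurable P"
    by (rule iid_seq_random_variable[OF iid]) simp
  have int_X: "integrable P (X 1)" by (rule assms(3)) simp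
  have f_bound: "\<bar>f x\<bar> \<le> c" for x
    using c by (simp add: f_def)
  have int_f: "integrable P (\<lambda>\<omega>. f (X 1 \<omega>))"
    by (rule integrable_const_bound[where B=c]) (auto simp: f_bound simp del: One_nat_def)
  have iid_Y: "iid_seq P Y"
    unfolding Y_def by (rule iid_seq_compose[OF iid]) measurable
  have iid_Z: "iid_seq P Z"
    unfolding Z_def by (rule iid_seq_compose[OF iid]) measurable
  have tail: "\<bar>X 1 \<omega>\<bar> * indicator {\<omega>. \<bar>X 1 \<omega>\<bar> \<ge> c} \<omega> = \<bar>X 1 \<omega> - f (X 1 \<omega>)\<bar>" for \<omega>
    by (auto simp: f_def indicator_def)
  have U: "U = expectation (\<lambda>\<omega>. \<bar>X 1 \<omega> - f (X 1 \<omega>)\<bar>)"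
    unfolding U_def truncated_abs_moment_def tail ..
  have U_nonneg: "0 \<le> U"
    unfolding U by simp
  \<comment> \<open>The mean of \<open>X 1\<close> vanishes, so its parts below and above \<open>c\<close> have opposite means.\<close>
  have "b = - expectation (\<lambda>\<omega>. X 1 \<omega> - f (X 1 \<omega>))"
    using int_X int_f assms(4) by (simp add: b_def)
  then have b_le: "\<bar>b\<bar> \<le> U"
    unfolding U by simp

  have P_Y: "(\<epsilon> / 4)\<^sup>2 * prob {\<omega>\<in>space P. \<exists>k\<ge>m. \<epsilon> / 4 \<le> S Y k \<omega>} \<le> p"
  proof -
    have "(\<epsilon> / 4)\<^sup>2 * prob {\<omega>\<in>space P. \<exists>k\<ge>m. \<epsilon> / 4 \<le> S Y k \<omega>}
        \<le> expectation (\<lambda>\<omega>. (Y 1 \<omega>)\<^sup>2) / real m"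
      unfolding S_def
    proof (rule average_maximal_inequality_square[OF iid_Y, where C = "c + \<bar>b\<bar>"])
      show "\<bar>Y i \<omega>\<bar> \<le> c + \<bar>b\<bar>" for i \<omega>
        using f_bound[of "X i \<omega>"] unfolding Y_def by linarith
      show "expectation (Y 1) = 0"
        using int_f by (simp add: Y_def b_def prob_space)
    qed (use \<open>m \<ge> 1\<close> \<open>\<epsilon> > 0\<close> in auto)
    also have "expectation (\<lambda>\<omega>. (Y 1 \<omega>)\<^sup>2) \<le> c\<^sup>2"
    proof -
      have f2: "(f x)\<^sup>2 \<le> c\<^sup>2" for x
        using f_bound[of x] c by (simp add: abs_le_square_iff[symmetric])
      have int_f2: "integrable P (\<lambda>\<omega>. (f (X 1 \<omega>))\<^sup>2)"
        by (rule integrable_const_bound[where B="c\<^sup>2"]) (auto simp: f2 simp del: One_nat_def)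
      have "expectation (\<lambda>\<omega>. (Y 1 \<omega>)\<^sup>2) = expectation (\<lambda>\<omega>. (f (X 1 \<omega>))\<^sup>2) - b\<^sup>2"
        unfolding Y_def b_def using variance_eq[OF int_f int_f2] by simp
      also have "\<dots> \<le> expectation (\<lambda>\<omega>. (f (X 1 \<omega>))\<^sup>2)" by simp
      also have "\<dots> \<le> c\<^sup>2"
        by (rule integral_le_const[OF int_f2]) (simp add: f2)
      finally show ?thesis .
    qed
    also have "c\<^sup>2 / real m = p"
      using m by (simp add: c_def p_def powr_diff powr_powr powr_realpow[symmetric] mult.commute)
    finally show ?thesis using m by (simp add: divide_right_mono)
  qed

  have P_Z: "(\<epsilon> / 4) * prob {\<omega>\<in>space P. \<exists>k\<ge>m. \<epsilon> / 4 \<le> S Z k \<omega>} \<le> 2 * U"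
  proof -
    have int_Z: "integrable P (Z 1)"
      using int_X int_f by (simp add: Z_def)
    have "(\<epsilon> / 4) * prob {\<omega>\<in>space P. \<exists>k\<ge>m. \<epsilon> / 4 \<le> S Z k \<omega>} \<le> expectation (\<lambda>\<omega>. \<bar>Z 1 \<omega>\<bar>)"
      unfolding S_def by (rule average_maximal_inequality_abs[OF iid_Z int_Z \<open>m \<ge> 1\<close>])
    also have "\<dots> \<le> expectation (\<lambda>\<omega>. \<bar>X 1 \<omega> - f (X 1 \<omega>)\<bar> + \<bar>b\<bar>)"
      using int_X int_f int_Z by (intro integral_mono) (auto simp: Z_def)
    also have "\<dots> = U + \<bar>b\<bar>"
      using int_X int_f by (simp add: U prob_space)
    finally show ?thesis using b_le by simp
  qed

  have split: "partial_sum X k \<omega> = partial_sum Y k \<omega> + partial_sum Z k \<omega>" for k \<omega>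
    by (simp add: partial_sum_def Y_def Z_def sum.distrib[symmetric])
  have meas: "{\<omega>\<in>space P. \<exists>k\<ge>m. \<epsilon> / 4 \<le> S V k \<omega>} \<in> sets P" if "iid_seq P V" for V
  proof -
    have [measurable]: "V i \<in> borel_measurable P" if "i \<in> {1..}" for i
      using iid_seq_random_variable[OF \<open>iid_seq P V\<close>] that by auto
    have [measurable]: "S V k \<in> borel_measurable P" for k
      unfolding S_def partial_sum_def by measurable
    show ?thesis by measurable
  qed
  \<comment> \<open>The supremum need not be attained, so some average is only known to exceed \<open>\<epsilon> / 2\<close>;
    one of its two parts then reaches \<open>\<epsilon> / 4\<close>.\<close>
  have incl: "{\<omega>\<in>space P. (SUP k\<in>{m..}. ereal (\<bar>partial_sum X k \<omega>\<bar> / real k)) \<ge> ereal \<epsilon>}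
      \<subseteq> {\<omega>\<in>space P. \<exists>k\<ge>m. \<epsilon> / 4 \<le> S Y k \<omega>} \<union> {\<omega>\<in>space P. \<exists>k\<ge>m. \<epsilon> / 4 \<le> S Z k \<omega>}"
  proof safe
    fix \<omega> assume \<omega>: "ereal \<epsilon> \<le> (SUP k\<in>{m..}. ereal (\<bar>partial_sum X k \<omega>\<bar> / real k))"
      and no: "\<not> (\<exists>k\<ge>m. \<epsilon> / 4 \<le> S Z k \<omega>)"
    have "ereal (\<epsilon> / 2) < ereal \<epsilon>" using \<open>\<epsilon> > 0\<close> by simp
    also note \<omega>
    finally obtain k where k: "k \<ge> m" "\<epsilon> / 2 < \<bar>partial_sum X k \<omega>\<bar> / real k"
      by (auto simp: less_SUP_iff)
    have "\<bar>partial_sum X k \<omega>\<bar> / real k \<le> S Y k \<omega> + S Z k \<omega>"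
      unfolding S_def split using abs_triangle_ineq[of "partial_sum Y k \<omega> / real k" "partial_sum Z k \<omega> / real k"]
      by (simp add: add_divide_distrib[symmetric])
    moreover have "S Z k \<omega> < \<epsilon> / 4" using no k(1) by force
    ultimately have "\<epsilon> / 4 \<le> S Y k \<omega>" using k(2) by linarith
    then show "\<exists>k\<ge>m. \<epsilon> / 4 \<le> S Y k \<omega>" using k(1) by blast
  qed
  define \<delta> where "\<delta> = min (\<epsilon>\<^sup>2) 1"
  have \<delta>: "0 < \<delta>" "\<delta> \<le> \<epsilon>\<^sup>2"
    using \<open>\<epsilon> > 0\<close> by (auto simp: \<delta>_def)
  have \<delta>_le: "\<delta> \<le> \<epsilon>"
  proof (cases "\<epsilon> \<le> 1")
    case True
    then have "\<epsilon>\<^sup>2 \<le> \<epsilon>"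
      using \<open>\<epsilon> > 0\<close> by (simp add: power2_eq_square mult_left_le)
    then show ?thesis using \<delta>(2) by simp
  qed (simp add: \<delta>_def)
  have "prob {\<omega>\<in>space P. (SUP k\<in>{m..}. ereal (\<bar>partial_sum X k \<omega>\<bar> / real k)) \<ge> ereal \<epsilon>}
      \<le> prob {\<omega>\<in>space P. \<exists>k\<ge>m. \<epsilon> / 4 \<le> S Y k \<omega>} + prob {\<omega>\<in>space P. \<exists>k\<ge>m. \<epsilon> / 4 \<le> S Z k \<omega>}"
    (is "_ \<le> ?pY + ?pZ")
    by (rule order_trans[OF finite_measure_mono[OF incl] measure_Un_le])
       (intro sets.Un meas iid_Y iid_Z)+
  also have "\<dots> \<le> 262 / \<delta> * (p + U)"
  proof -
    have "\<delta> * ?pY \<le> \<epsilon>\<^sup>2 * ?pY" "\<delta> * ?pZ \<le> \<epsilon> * ?pZ"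
      using \<delta>(2) \<delta>_le by (auto intro: mult_right_mono)
    moreover have "\<epsilon>\<^sup>2 * ?pY \<le> 16 * p" using P_Y by (simp add: power_divide)
    moreover have "\<epsilon> * ?pZ \<le> 8 * U" using P_Z by simp
    moreover have "0 \<le> p" by (simp add: p_def)
    ultimately have "\<delta> * (?pY + ?pZ) \<le> 262 * (p + U)"
      using U_nonneg unfolding distrib_left by linarith
    then show ?thesis using \<delta>(1) by (simp add: pos_le_divide_eq mult.commute)
  qed
  finally show ?thesis unfolding \<delta>_def p_def U_def c_def .
qed

end
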